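(* Fix $\theta\in\mathbb{R}$. If the mixed-binary quadratic program $\mathcal{P}^{\mathrm{MBQP}}(\theta)$ is feasible and satisfies the bounded-continuous-variables assumption (for each $i\in[n]\setminus\mathcal{B}$ there is a finite $U_i$ such that every feasible $x$ of $\mathcal{P}^{\mathrm{MBQP}}(\theta)$ satisfies $x_i\le U_i$), then strong duality holds between the semidefinite relaxation $\mathcal{P}^{\mathrm{SDP\text{-}bd}}(\theta)$ and its dual $\mathcal{P}^{\mathrm{SDP\text{-}dual}}(\theta)$, i.e. their optimal values are equal.
   Context: Data: integers $n,m\ge 1$, a symmetric positive semidefinite matrix $Q\in\mathbb{R}^{n\times n}$, $c\in\mathbb{R}^n$, $a_1,\dots,a_m\in\mathbb{R}^n$, a set $\mathcal{B}\subseteq[n]=\{1,\dots,n\}$, and differentiable functions $b_1,\dots,b_m:\mathbb{R}\to\mathbb{R}$ of a scalar parameter $\theta$. For matrices, $\succeq 0$ means symmetric positive semidefinite and $\ge 0$ means entrywise nonnegative. $\mathcal{P}^{\mathrm{MBQP}}(\theta)$: minimize $x^\top Qx+c^\top x$ over $x\in\mathbb{R}^n_+$ subject to $a_j^\top x=b_j(\theta)$ for $j=1,\dots,m$ and $x_i\in\{0,1\}$ for $i\in\mathcal{B}$. $\mathcal{P}^{\mathrm{SDP\text{-}bd}}(\theta)$: minimize $\mathrm{Tr}(Q^\top X)+c^\top x$ over $x\in\mathbb{R}^n$ and symmetric $X\in\mathbb{R}^{n\times n}$, with $Y:=\begin{bmatrix}1 & x^\top \\ x & X\end{bmatrix}$,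 subject to (multipliers in brackets): $a_j^\top x=b_j(\theta)$, $j=1,\dots,m$ $[\gamma_j]$; $\mathrm{Tr}(a_ja_j^\top X)=b_j(\theta)^2$, $j=1,\dots,m$ $[\omega_j]$; $X_{ii}\le U_i^2$, $i\in[n]\setminus\mathcal{B}$ $[\phi_i]$; $x_i=X_{ii}$, $i\in\mathcal{B}$ $[\kappa_i]$; $Y\succeq 0$ $[\Omega]$; $Y\ge 0$ $[\Theta]$. $\mathcal{P}^{\mathrm{SDP\text{-}dual}}(\theta)$: maximize $$\sum_{j=1}^m b_j(\theta)\gamma_j+\sum_{j=1}^m b_j(\theta)^2\omega_j+\mu+\sum_{i\in[n]\setminus\mathcal{B}}U_i^2\phi_i$$ over $\gamma,\omega\in\mathbb{R}^m$, $\kappa\in\mathbb{R}^{\mathcal{B}}$, $\phi\in\mathbb{R}^{[n]\setminus\mathcal{B}}$ with $\phi\le 0$, $\mu\in\mathbb{R}$, and symmetric $(n+1)\times(n+1)$ matrices $\Theta\ge 0$, $\Omega\succeq 0$, subject to $$C-\sum_{j}\gamma_jA_j-\sum_j\omega_j\hat A_j-\sum_{i\in\mathcal{B}}\kappa_iB_i-\sum_{i\in[n]\setminus\mathcal{B}}\phi_iG_i-\mu H=\Theta+\Omega,$$ where, $e_i$ denoting the $i$-th unit vector of $\mathbb{R}^n$, $C=\begin{bmatrix}0&\frac12c^\top \\ \frac12c&Q\end{bmatrix}$, $A_j=\begin{bmatrix}0&\frac12a_j^\top \\ \frac12a_j&0\end{bmatrix}$, $\hat A_j=\begin{bmatrix}0&0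 \\ 0&a_ja_j^\top\end{bmatrix}$, $B_i=\begin{bmatrix}0&\frac12e_i^\top \\ \frac12e_i&-e_ie_i^\top\end{bmatrix}$, $G_i=\begin{bmatrix}0&0 \\ 0&e_ie_i^\top\end{bmatrix}$, $H=\begin{bmatrix}1&0 \\ 0&0\end{bmatrix}$. ($\mu$ is the multiplier of the normalization $Y_{11}=1$.) Optimal values are understood as infimum for the primal and supremum for the dual. *)

theory Defs
  imports "HOL-Analysis.Analysis"
begin

text \<open>
  Dimensions are index types: \<open>'n\<close> plays the role of \<open>[n]\<close> and \<open>'m\<close> that of
  \<open>{1,\<dots>,m}\<close>. Matrices of order \<open>n + 1\<close> are indexed by \<open>'n option\<close>, where \<open>None\<close> is
  the additional first row and column. The set of binary indices is \<open>B\<close>, so that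
  the continuous indices are \<open>- B\<close>.
\<close>

definition psd :: "real^'k^'k \<Rightarrow> bool" where
  "psd M \<longleftrightarrow> transpose M = M \<and> (\<forall>v. 0 \<le> v \<bullet> (M *v v))"

definition entrywise_nonneg :: "real^'k^'l \<Rightarrow> bool" where
  "entrywise_nonneg M \<longleftrightarrow> (\<forall>i j. 0 \<le> M $ i $ j)"

definition outer :: "real^'n \<Rightarrow> real^'n \<Rightarrow> real^'n^'n" where
  "outer v w = (\<chi> i j. v $ i * w $ j)"

text \<open>\<open>bordered t v M\<close> is the block matrix with rows \<open>[t, v\<^sup>T]\<close> and \<open>[v, M]\<close>.\<close>

definition bordered ::
    "real \<Rightarrow> real^'n \<Rightarrow> real^'n^'n \<Rightarrow> real^('n option)^('n option)" where
  "bordered t v M = (\<chi> p q.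
     (case p of
        None \<Rightarrow> (case q of None \<Rightarrow> t | Some j \<Rightarrow> v $ j)
      | Some i \<Rightarrow> (case q of None \<Rightarrow> v $ i | Some j \<Rightarrow> M $ i $ j)))"


subsection \<open>The mixed-binary quadratic program\<close>

text \<open>
  Only the feasible region is needed; the objective \<open>x\<^sup>T Q x + c\<^sup>T x\<close> enters the
  two semidefinite programs through \<open>Q\<close> and \<open>c\<close>.
\<close>

definition mbqp_feasible ::
    "('m \<Rightarrow> real^'n) \<Rightarrow> 'n set \<Rightarrow> ('m \<Rightarrow> real \<Rightarrow> real) \<Rightarrow> real \<Rightarrow> real^'n \<Rightarrow> bool" where
  "mbqp_feasible a B b \<theta> x \<longleftrightarrow>
     (\<forall>i. 0 \<le> x $ i) \<and>
     (\<forall>j. a j \<bullet> x = b j \<theta>) \<and>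
     (\<forall>i\<in>B. x $ i \<in> {0, 1})"


subsection \<open>The semidefinite relaxation\<close>

definition sdp_bd_objective ::
    "real^'n^'n \<Rightarrow> real^'n \<Rightarrow> real^'n \<Rightarrow> real^'n^'n \<Rightarrow> real" where
  "sdp_bd_objective Q c x X = trace (transpose Q ** X) + c \<bullet> x"

definition sdp_bd_feasible ::
    "('m \<Rightarrow> real^'n) \<Rightarrow> 'n set \<Rightarrow> ('n \<Rightarrow> real) \<Rightarrow> ('m \<Rightarrow> real \<Rightarrow> real) \<Rightarrow> real
     \<Rightarrow> real^'n \<Rightarrow> real^'n^'n \<Rightarrow> bool" where
  "sdp_bd_feasible a B U b \<theta> x X \<longleftrightarrow>
     transpose X = X \<and>
     (\<forall>j. a j \<bullet> x = b j \<theta>) \<and>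
     (\<forall>j. trace (outer (a j) (a j) ** X) = (b j \<theta>)\<^sup>2) \<and>
     (\<forall>i\<in>-B. X $ i $ i \<le> (U i)\<^sup>2) \<and>
     (\<forall>i\<in>B. x $ i = X $ i $ i) \<and>
     psd (bordered 1 x X) \<and>
     entrywise_nonneg (bordered 1 x X)"

definition sdp_bd_value ::
    "real^'n^'n \<Rightarrow> real^'n \<Rightarrow> ('m \<Rightarrow> real^'n) \<Rightarrow> 'n set \<Rightarrow> ('n \<Rightarrow> real)
     \<Rightarrow> ('m \<Rightarrow> real \<Rightarrow> real) \<Rightarrow> real \<Rightarrow> ereal" where
  "sdp_bd_value Q c a B U b \<theta> =
     Inf {ereal (sdp_bd_objective Q c x X) | x X. sdp_bd_feasible a B U b \<theta> x X}"


subsection \<open>The dual program\<close>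

definition dual_C :: "real^'n^'n \<Rightarrow> real^'n \<Rightarrow> real^('n option)^('n option)" where
  "dual_C Q c = bordered 0 ((1/2) *\<^sub>R c) Q"

definition dual_A :: "real^'n \<Rightarrow> real^('n option)^('n option)" where
  "dual_A v = bordered 0 ((1/2) *\<^sub>R v) 0"

definition dual_A_hat :: "real^'n \<Rightarrow> real^('n option)^('n option)" where
  "dual_A_hat v = bordered 0 0 (outer v v)"

definition dual_B :: "'n::finite \<Rightarrow> real^('n option)^('n option)" where
  "dual_B i = bordered 0 ((1/2) *\<^sub>R axis i 1) (- outer (axis i 1) (axis i 1))"

definition dual_G :: "'n::finite \<Rightarrow> real^('n option)^('n option)" where
  "dual_G i = bordered 0 0 (outer (axis i 1) (axis i 1))"

definition dual_H :: "real^('n::finite option)^('n option)" where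
  "dual_H = bordered 1 0 0"

text \<open>
  The multipliers \<open>\<kappa>\<close> and \<open>\<phi>\<close> are total on \<open>'n\<close>, but the dual program reads \<open>\<kappa>\<close> only on
  \<open>B\<close> and \<open>\<phi>\<close> only on \<open>- B\<close>, so they stand for vectors indexed by \<open>B\<close> and \<open>- B\<close>.
\<close>

definition sdp_dual_objective ::
    "'n set \<Rightarrow> ('n::finite \<Rightarrow> real) \<Rightarrow> ('m::finite \<Rightarrow> real \<Rightarrow> real) \<Rightarrow> real
     \<Rightarrow> real^'m \<Rightarrow> real^'m \<Rightarrow> ('n \<Rightarrow> real) \<Rightarrow> real \<Rightarrow> real" where
  "sdp_dual_objective B U b \<theta> \<gamma> \<omega> \<phi> \<mu> =
     (\<Sum>j\<in>UNIV. b j \<theta> * \<gamma> $ j) + (\<Sum>j\<in>UNIV. (b j \<theta>)\<^sup>2 * \<omega> $ j) + \<mu>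
     + (\<Sum>i\<in>-B. (U i)\<^sup>2 * \<phi> i)"

definition sdp_dual_feasible ::
    "real^'n^'n \<Rightarrow> real^'n \<Rightarrow> ('m::finite \<Rightarrow> real^'n) \<Rightarrow> 'n set
     \<Rightarrow> real^'m \<Rightarrow> real^'m \<Rightarrow> ('n \<Rightarrow> real) \<Rightarrow> ('n \<Rightarrow> real) \<Rightarrow> real
     \<Rightarrow> real^('n option)^('n option) \<Rightarrow> real^('n option)^('n option) \<Rightarrow> bool" where
  "sdp_dual_feasible Q c a B \<gamma> \<omega> \<kappa> \<phi> \<mu> \<Theta> \<Omega> \<longleftrightarrow>
     (\<forall>i\<in>-B. \<phi> i \<le> 0) \<and>
     transpose \<Theta> = \<Theta> \<and> entrywise_nonneg \<Theta> \<and>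
     psd \<Omega> \<and>
     dual_C Q c
       - (\<Sum>j\<in>UNIV. \<gamma> $ j *\<^sub>R dual_A (a j))
       - (\<Sum>j\<in>UNIV. \<omega> $ j *\<^sub>R dual_A_hat (a j))
       - (\<Sum>i\<in>B. \<kappa> i *\<^sub>R dual_B i)
       - (\<Sum>i\<in>-B. \<phi> i *\<^sub>R dual_G i)
       - \<mu> *\<^sub>R dual_H
     = \<Theta> + \<Omega>"

definition sdp_dual_value ::
    "real^'n^'n \<Rightarrow> real^'n \<Rightarrow> ('m::finite \<Rightarrow> real^'n) \<Rightarrow> 'n set \<Rightarrow> ('n \<Rightarrow> real)
     \<Rightarrow> ('m \<Rightarrow> real \<Rightarrow> real) \<Rightarrow> real \<Rightarrow> ereal" where
  "sdp_dual_value Q c a B U b \<theta> =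
     Sup {ereal (sdp_dual_objective B U b \<theta> \<gamma> \<omega> \<phi> \<mu>) | \<gamma> \<omega> \<kappa> \<phi> \<mu> \<Theta> \<Omega>.
            sdp_dual_feasible Q c a B \<gamma> \<omega> \<kappa> \<phi> \<mu> \<Theta> \<Omega>}"

end

theory Submission
  imports Defs
begin

text \<open>
  A conic program can have a duality gap. Here the gap is excluded because the recession cone
  of the relaxation is trivial: a positive semidefinite \<open>Y\<close> that satisfies the homogeneous
  versions of the constraints has \<open>Y\<^sub>1\<^sub>1 = 0\<close>, hence a zero first row \<open>x\<close>; then \<open>X\<^sub>i\<^sub>i = x\<^sub>i = 0\<close> for binary \<open>i\<close> and
  \<open>X\<^sub>i\<^sub>i \<le> 0\<close> for continuous \<open>i\<close>, so the diagonal of \<open>Y\<close>, and with it \<open>Y\<close>, vanishes. It is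
  the upper bounds on the \<open>X\<^sub>i\<^sub>i\<close> with continuous \<open>i\<close> that make this work.

  Weak duality is the nonnegativity of \<open>\<Theta> \<bullet> Y\<close> and \<open>\<Omega> \<bullet> Y\<close>; the latter is
  \<open>psd_inner_nonneg\<close>. For the converse, suppose that no dual feasible point has value at least
  \<open>t\<close>. Then the convex set \<open>dual_defects\<close>, of the errors that multipliers make in the dual
  equation and in reaching the value \<open>t\<close>, avoids the origin, and lies on one side of
  a hyperplane through the origin with normal \<open>(Y, z) \<noteq> 0\<close>. Because the multipliers range over cones
  and linear spaces, the resulting inequality says that \<open>Y\<close> is symmetric, entrywise
  nonnegative and positive semidefinite, and satisfies the constraints of the relaxation
  scaled by \<open>z = Y\<^sub>1\<^sub>1 \<ge> 0\<close>. If \<open>z = 0\<close>, then \<open>Y\<close> is a nonzero recession direction, which does not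
  exist; so \<open>Y/z\<close> is primal feasible, and its value is at most \<open>t\<close>
  (\<open>unreachable_dual_value_bounds_primal\<close>). Hence no real number lies strictly between the two
  values. The separation is of a point from a convex set in finite dimension, so no closedness of
  cones is involved.
\<close>

section \<open>Positive semidefinite matrices and the trace inner product\<close>

lemma inner_outer: "outer v w \<bullet> N = v \<bullet> (N *v w)"
  by (simp add: inner_vec_def outer_def matrix_vector_mult_def sum_distrib_left mult_ac)

lemma inner_transpose: "transpose M \<bullet> transpose N = M \<bullet> (N :: real^'k^'l)"
  unfolding inner_vec_def transpose_def by (simp, rule sum.swap)

lemma trace_transpose_mult: "trace (transpose M ** N) = M \<bullet> (N :: real^'k^'l)"
  unfolding trace_def transpose_def matrix_matrix_mult_def inner_vec_def
  by (simp, rule sum.swap)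

lemma trace_outer_mult: "trace (outer v v ** X) = outer v v \<bullet> X"
proof -
  have "transpose (outer v v) = outer v v"
    by (simp add: outer_def transpose_def vec_eq_iff mult.commute)
  then show ?thesis by (metis trace_transpose_mult)
qed

lemma matrix_vector_axis: "(M :: real^'k^'l) *v axis i 1 = column i M"
  by (simp add: matrix_vector_mult_basis)

lemma sum_axis_mult: "(\<Sum>j\<in>UNIV. axis i k $ j * f j) = k * (f i :: real)"
  by (simp add: axis_def if_distrib[of "\<lambda>y. y * _"] cong: if_cong)

lemma sum_single_multiplier:
  fixes f :: "'a \<Rightarrow> real"
  assumes "finite S" "i \<in> S"
  shows "(\<Sum>i'\<in>S. (if i' = i then k else 0) * f i') = k * f i"
  using assms by (simp add: if_distrib[of "\<lambda>y. y * _"] cong: if_cong)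

lemma symmetric_nth: "transpose M = M \<Longrightarrow> M $ i $ j = M $ j $ i"
  by (metis transpose_def vec_lambda_beta)

lemma inner_symmetric_matrix:
  fixes M :: "real^'k^'k"
  assumes "transpose M = M"
  shows "v \<bullet> (M *v w) = w \<bullet> (M *v v)"
  by (metis assms dot_lmul_matrix inner_commute matrix_vector_mul_assoc transpose_matrix_vector)

lemma quadratic_form_along_line:
  fixes M :: "real^'k^'k"
  assumes "transpose M = M"
  shows "(v + s *\<^sub>R axis i 1) \<bullet> (M *v (v + s *\<^sub>R axis i 1))
       = v \<bullet> (M *v v) + 2 * s * (v \<bullet> M $ i) + s\<^sup>2 * M $ i $ i"
proof -
  have e: "M *v axis i 1 = M $ i"
    using assms by (simp add: matrix_vector_axis column_def vec_eq_iff symmetric_nth)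
  have "axis i 1 \<bullet> (M *v v) = v \<bullet> M $ i"
    using inner_symmetric_matrix[OF assms, of "axis i 1" v] e by simp
  then show ?thesis
    using e by (simp add: matrix_vector_right_distrib scaleR_matrix_vector_assoc
        matrix_vector_mult_scaleR inner_add_left inner_add_right power2_eq_square
        inner_axis' algebra_simps)
qed

lemma nonneg_on_ray_imp_slope_nonneg:
  fixes \<alpha> \<beta> :: real
  assumes "\<And>k. 0 \<le> k \<Longrightarrow> 0 \<le> \<beta> + k * \<alpha>"
  shows "0 \<le> \<alpha>"
proof (rule ccontr)
  assume neg: "\<not> 0 \<le> \<alpha>"
  define k where "k = (\<bar>\<beta>\<bar> + 1) / - \<alpha>"
  have "0 \<le> k" unfolding k_def using neg by (intro divide_nonneg_nonneg) auto
  moreover have "k * \<alpha> = - (\<bar>\<beta>\<bar> + 1)" unfolding k_def using neg by simp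
  ultimately show False using assms[of k] by linarith
qed

lemma nonneg_on_line_imp_slope_zero:
  fixes \<alpha> \<beta> :: real
  assumes "\<And>k. 0 \<le> \<beta> + k * \<alpha>"
  shows "\<alpha> = 0"
  using nonneg_on_ray_imp_slope_nonneg[of \<beta> \<alpha>] nonneg_on_ray_imp_slope_nonneg[of \<beta> "- \<alpha>"]
    assms assms[of "- k" for k] by (metis minus_mult_commute neg_0_le_iff_le order_antisym)

text \<open>
  Along the line \<open>v + s e\<^sub>i\<close> the quadratic form is affine in \<open>s\<close> when \<open>M\<^sub>i\<^sub>i = 0\<close>, so it stays
  nonnegative only if its slope, twice the product of \<open>v\<close> with row \<open>i\<close>, vanishes.
\<close>

lemma psd_zero_diagonal_imp_zero_row:
  assumes "psd M" and "M $ i $ i = 0"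
  shows "M $ i = 0"
proof -
  have "v \<bullet> M $ i = 0" for v
  proof -
    have "0 \<le> v \<bullet> (M *v v) + s * (2 * (v \<bullet> M $ i))" for s
    proof -
      have "0 \<le> (v + s *\<^sub>R axis i 1) \<bullet> (M *v (v + s *\<^sub>R axis i 1))"
        using assms(1) by (simp add: psd_def)
      then show ?thesis
        using assms quadratic_form_along_line[of M v s i] by (simp add: psd_def algebra_simps)
    qed
    then show ?thesis
      using nonneg_on_line_imp_slope_zero[of "v \<bullet> (M *v v)" "2 * (v \<bullet> M $ i)"] by simp
  qed
  then show ?thesis by (metis inner_eq_zero_iff)
qed

text \<open>
  One step of symmetric Gaussian elimination: the form of the complement at \<open>v\<close> is the minimum of
  the form of \<open>M\<close> over the line \<open>v + s e\<^sub>i\<close>.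
\<close>

lemma psd_schur_complement:
  assumes "psd M" and pos: "M $ i $ i > 0"
  shows "psd (M - (1 / M $ i $ i) *\<^sub>R outer (M $ i) (M $ i))"
  unfolding psd_def
proof (intro conjI allI)
  have sym: "transpose M = M" using assms(1) by (simp add: psd_def)
  show "transpose (M - (1 / M $ i $ i) *\<^sub>R outer (M $ i) (M $ i))
      = M - (1 / M $ i $ i) *\<^sub>R outer (M $ i) (M $ i)"
    using symmetric_nth[OF sym] by (simp add: transpose_def outer_def vec_eq_iff mult.commute)
  fix v
  \<comment> \<open>The minimizer of the form along the line.\<close>
  define s where "s = - (v \<bullet> M $ i) / M $ i $ i"
  have "outer (M $ i) (M $ i) *v v = (v \<bullet> M $ i) *\<^sub>R M $ i"
    by (simp add: vec_eq_iff outer_def matrix_vector_mult_def inner_vec_def sum_distrib_right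
        sum_distrib_left mult_ac)
  then have "v \<bullet> ((M - (1 / M $ i $ i) *\<^sub>R outer (M $ i) (M $ i)) *v v)
      = v \<bullet> (M *v v) - (v \<bullet> M $ i)\<^sup>2 / M $ i $ i"
    by (simp add: matrix_vector_mult_diff_rdistrib scaleR_matrix_vector_assoc[symmetric]
        inner_diff_right power2_eq_square)
  also have "\<dots> = (v + s *\<^sub>R axis i 1) \<bullet> (M *v (v + s *\<^sub>R axis i 1))"
    unfolding quadratic_form_along_line[OF sym] s_def
    using pos by (simp add: field_simps power2_eq_square)
  also have "\<dots> \<ge> 0" using assms(1) by (simp add: psd_def)
  finally show "0 \<le> v \<bullet> ((M - (1 / M $ i $ i) *\<^sub>R outer (M $ i) (M $ i)) *v v)" .
qed

lemma psd_diagonal_nonneg: "psd M \<Longrightarrow> 0 \<le> M $ i $ i"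
  unfolding psd_def
  by (metis column_def inner_axis' inner_real_def matrix_vector_axis mult_1 vec_lambda_beta)

text \<open>
  A positive semidefinite \<open>M\<close> is a nonnegative combination of matrices \<open>m m\<^sup>T\<close>, for which
  \<open>m m\<^sup>T \<bullet> N = m\<^sup>T N m \<ge> 0\<close>. Elimination splits these off one at a time; the induction is over a
  set \<open>S\<close> that contains the indices of the nonzero rows.
\<close>

lemma psd_inner_nonneg:
  assumes "psd M" and "psd N"
  shows "0 \<le> M \<bullet> N"
proof -
  have "0 \<le> M \<bullet> N" if "finite S" "psd M" "\<And>k. k \<notin> S \<Longrightarrow> M $ k = 0" for S M
    using that
  proof (induction S arbitrary: M rule: finite_induct)
    case empty
    then have "M = 0" by (simp add: vec_eq_iff)
    then show ?case by simp
  next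
    case (insert i S)
    show ?case
    proof (cases "M $ i $ i = 0")
      case True
      then have "M $ i = 0" using insert.prems(1) psd_zero_diagonal_imp_zero_row by blast
      then show ?thesis using insert by (metis insert_iff)
    next
      case False
      then have pos: "M $ i $ i > 0" using insert.prems(1) psd_diagonal_nonneg[of M i] by simp
      define m where "m = M $ i"
      define M' where "M' = M - (1 / M $ i $ i) *\<^sub>R outer m m"
      have "M' $ k = 0" if "k \<notin> S" for k
      proof (cases "k = i")
        case True
        then show ?thesis using pos by (simp add: M'_def m_def outer_def vec_eq_iff)
      next
        case False
        then have "M $ k = 0" using insert.prems(2) that by simp
        moreover from this have "m $ k = 0"
          using insert.prems(1) unfolding m_def psd_def by (metis symmetric_nth zero_index)
        ultimately show ?thesis by (simp add: M'_def outer_def vec_eq_iff)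
      qed
      moreover have "psd M'"
        using psd_schur_complement[OF insert.prems(1) pos] by (simp add: M'_def m_def)
      ultimately have "0 \<le> M' \<bullet> N" using insert.IH by blast
      moreover have "0 \<le> outer m m \<bullet> N"
        using assms(2) by (simp add: inner_outer psd_def)
      moreover have "M \<bullet> N = M' \<bullet> N + (1 / M $ i $ i) * (outer m m \<bullet> N)"
        by (simp add: M'_def inner_diff_left)
      ultimately show ?thesis using pos by simp
    qed
  qed
  from this[of UNIV M] show ?thesis using assms(1) by simp
qed

lemma entrywise_nonneg_inner_nonneg:
  "entrywise_nonneg M \<Longrightarrow> entrywise_nonneg N \<Longrightarrow> 0 \<le> M \<bullet> N"
  by (auto simp: entrywise_nonneg_def inner_vec_def intro!: sum_nonneg)

section \<open>Bordered matrices\<close>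

lemma sum_UNIV_option: "(\<Sum>p\<in>UNIV. f p) = f None + (\<Sum>i\<in>UNIV. f (Some i :: 'n::finite option))"
  by (simp add: UNIV_option_conv sum.reindex)

lemma bordered_nth [simp]:
  "bordered t v M $ None $ None = t" "bordered t v M $ None $ Some j = v $ j"
  "bordered t v M $ Some i $ None = v $ i" "bordered t v M $ Some i $ Some j = M $ i $ j"
  by (simp_all add: bordered_def)

lemma inner_bordered: "bordered t v M \<bullet> bordered s w N = t * s + 2 * (v \<bullet> w) + M \<bullet> N"
  by (simp add: inner_vec_def sum_UNIV_option sum.distrib)

lemma vec_eq_option_iff: "x = y \<longleftrightarrow> x $ None = y $ None \<and> (\<forall>i. x $ Some i = y $ Some i)"
  by (metis (full_types) option.exhaust vec_eq_iff)

lemma scaleR_bordered: "k *\<^sub>R bordered t v M = bordered (k * t) (k *\<^sub>R v) (k *\<^sub>R M)"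
  by (simp add: vec_eq_option_iff)

lemma transpose_bordered: "transpose (bordered t v M) = bordered t v (transpose M)"
  by (simp add: vec_eq_option_iff transpose_def)

lemma symmetric_is_bordered:
  assumes "transpose Y = Y"
  obtains t v M where "Y = bordered t v M" "transpose M = M"
proof
  show "Y = bordered (Y $ None $ None) (\<chi> i. Y $ None $ Some i) (\<chi> i j. Y $ Some i $ Some j)"
    using symmetric_nth[OF assms] by (simp add: vec_eq_option_iff)
  show "transpose (\<chi> i j. Y $ Some i $ Some j) = (\<chi> i j. Y $ Some i $ Some j)"
    using symmetric_nth[OF assms] by (simp add: transpose_def vec_eq_iff)
qed

section \<open>The Lagrangian and weak duality\<close>

text \<open>
  The matrix that dual feasibility requires to be \<open>\<Theta> + \<Omega>\<close>, as an affine function of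
  arbitrary multipliers; the separation argument uses it at infeasible ones too.
\<close>

definition dual_slack ::
    "real^'n^'n \<Rightarrow> real^'n \<Rightarrow> ('m::finite \<Rightarrow> real^'n) \<Rightarrow> 'n set
     \<Rightarrow> real^'m \<Rightarrow> real^'m \<Rightarrow> ('n \<Rightarrow> real) \<Rightarrow> ('n \<Rightarrow> real) \<Rightarrow> real
     \<Rightarrow> real^('n option)^('n option)" where
  "dual_slack Q c a B \<gamma> \<omega> \<kappa> \<phi> \<mu> =
     dual_C Q c
       - (\<Sum>j\<in>UNIV. \<gamma> $ j *\<^sub>R dual_A (a j))
       - (\<Sum>j\<in>UNIV. \<omega> $ j *\<^sub>R dual_A_hat (a j))
       - (\<Sum>i\<in>B. \<kappa> i *\<^sub>R dual_B i)
       - (\<Sum>i\<in>-B. \<phi> i *\<^sub>R dual_G i)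
       - \<mu> *\<^sub>R dual_H"

lemma inner_outer_axis: "outer (axis i 1) (axis i 1) \<bullet> X = X $ i $ i"
  by (simp add: inner_outer matrix_vector_axis inner_axis' column_def)

text \<open>
  The Lagrangian, with the multipliers collected by constraint. The corner entry \<open>s\<close> and the weight
  \<open>z\<close> of the dual objective are both 1 in weak duality; in the separation argument they
  are unknown a priori, and the coefficient of \<open>\<mu>\<close> forces them to agree.
\<close>

lemma lagrangian_identity:
  "dual_slack Q c a B \<gamma> \<omega> \<kappa> \<phi> \<mu> \<bullet> bordered s x X + z * sdp_dual_objective B U b \<theta> \<gamma> \<omega> \<phi> \<mu>
   = c \<bullet> x + Q \<bullet> X
     + (\<Sum>j\<in>UNIV. \<gamma> $ j * (z * b j \<theta> - a j \<bullet> x))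
     + (\<Sum>j\<in>UNIV. \<omega> $ j * (z * (b j \<theta>)\<^sup>2 - outer (a j) (a j) \<bullet> X))
     - (\<Sum>i\<in>B. \<kappa> i * (x $ i - X $ i $ i))
     + (\<Sum>i\<in>-B. \<phi> i * (z * (U i)\<^sup>2 - X $ i $ i))
     + \<mu> * (z - s)"
  unfolding dual_slack_def sdp_dual_objective_def dual_C_def dual_A_def dual_A_hat_def dual_B_def
    dual_G_def dual_H_def inner_diff_left inner_sum_left inner_scaleR_left inner_bordered
    inner_minus_left inner_outer_axis
  by (simp add: inner_axis' sum_distrib_left sum_subtractf sum.distrib algebra_simps)

lemma weak_duality:
  assumes P: "sdp_bd_feasible a B U b \<theta> x X"
    and D: "sdp_dual_feasible Q c a B \<gamma> \<omega> \<kappa> \<phi> \<mu> \<Theta> \<Omega>"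
  shows "sdp_dual_objective B U b \<theta> \<gamma> \<omega> \<phi> \<mu> \<le> sdp_bd_objective Q c x X"
proof -
  let ?Y = "bordered 1 x X"
  have slack: "dual_slack Q c a B \<gamma> \<omega> \<kappa> \<phi> \<mu> = \<Theta> + \<Omega>"
    using D by (simp add: sdp_dual_feasible_def dual_slack_def)
  have "0 \<le> \<Theta> \<bullet> ?Y" "0 \<le> \<Omega> \<bullet> ?Y"
    using P D by (auto simp: sdp_dual_feasible_def sdp_bd_feasible_def
        intro: entrywise_nonneg_inner_nonneg psd_inner_nonneg)
  moreover have "(\<Sum>i\<in>-B. \<phi> i * ((U i)\<^sup>2 - X $ i $ i)) \<le> 0"
    using P D by (auto simp: sdp_dual_feasible_def sdp_bd_feasible_def
        intro!: sum_nonpos mult_nonpos_nonneg)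
  ultimately show ?thesis
    using P lagrangian_identity[of Q c a B \<gamma> \<omega> \<kappa> \<phi> \<mu> 1 x X 1 U b \<theta>]
    unfolding sdp_bd_objective_def trace_transpose_mult slack
    by (simp add: sdp_bd_feasible_def trace_outer_mult inner_add_left)
qed

section \<open>Separating the dual defects from the origin\<close>

lemma dual_slack_convex_combination:
  assumes "u + v = 1"
  shows "u *\<^sub>R dual_slack Q c a B \<gamma> \<omega> \<kappa> \<phi> \<mu> + v *\<^sub>R dual_slack Q c a B \<gamma>' \<omega>' \<kappa>' \<phi>' \<mu>'
    = dual_slack Q c a B (u *\<^sub>R \<gamma> + v *\<^sub>R \<gamma>') (u *\<^sub>R \<omega> + v *\<^sub>R \<omega>')
        (\<lambda>i. u * \<kappa> i + v * \<kappa>' i) (\<lambda>i. u * \<phi> i + v * \<phi>' i) (u * \<mu> + v * \<mu>')"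
proof -
  have "dual_C Q c = u *\<^sub>R dual_C Q c + v *\<^sub>R dual_C Q c"
    using assms by (simp flip: scaleR_left_distrib)
  then show ?thesis
    unfolding dual_slack_def
    by (simp add: scaleR_diff_right scaleR_sum_right scaleR_left_distrib sum.distrib)
qed

lemma dual_objective_combination:
  "u * sdp_dual_objective B U b \<theta> \<gamma> \<omega> \<phi> \<mu> + v * sdp_dual_objective B U b \<theta> \<gamma>' \<omega>' \<phi>' \<mu>'
    = sdp_dual_objective B U b \<theta> (u *\<^sub>R \<gamma> + v *\<^sub>R \<gamma>') (u *\<^sub>R \<omega> + v *\<^sub>R \<omega>')
        (\<lambda>i. u * \<phi> i + v * \<phi>' i) (u * \<mu> + v * \<mu>')"
  unfolding sdp_dual_objective_def
  by (simp add: sum_distrib_left sum.distrib algebra_simps)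

text \<open>
  The pairs of errors in the dual equation and in attaining the value \<open>t\<close>. The matrices \<open>\<Theta>\<close>
  and \<open>\<Omega>\<close> may be nonsymmetric: this forces a functional that is nonnegative on the set
  to have a symmetric matrix part, since \<open>\<Omega>\<close> may be any antisymmetric matrix.
\<close>

definition dual_defects ::
    "real^'n^'n \<Rightarrow> real^'n \<Rightarrow> ('m::finite \<Rightarrow> real^'n) \<Rightarrow> 'n set \<Rightarrow> ('n \<Rightarrow> real)
     \<Rightarrow> ('m \<Rightarrow> real \<Rightarrow> real) \<Rightarrow> real \<Rightarrow> real \<Rightarrow> ((real^('n option)^('n option)) \<times> real) set" where
  "dual_defects Q c a B U b \<theta> t =
     {(\<Theta> + \<Omega> - dual_slack Q c a B \<gamma> \<omega> \<kappa> \<phi> \<mu>,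
       r + t - sdp_dual_objective B U b \<theta> \<gamma> \<omega> \<phi> \<mu>) | \<gamma> \<omega> \<kappa> \<phi> \<mu> \<Theta> \<Omega> r.
        (\<forall>i\<in>-B. \<phi> i \<le> 0) \<and> entrywise_nonneg \<Theta> \<and> (\<forall>v. 0 \<le> v \<bullet> (\<Omega> *v v)) \<and> 0 \<le> r}"

lemma convex_dual_defects: "convex (dual_defects Q c a B U b \<theta> t)"
proof (rule convexI)
  fix p q and u v :: real
  assume p: "p \<in> dual_defects Q c a B U b \<theta> t" and q: "q \<in> dual_defects Q c a B U b \<theta> t"
    and uv: "0 \<le> u" "0 \<le> v" "u + v = 1"
  from p obtain \<gamma> \<omega> \<kappa> \<phi> \<mu> \<Theta> \<Omega> r where
    p1: "p = (\<Theta> + \<Omega> - dual_slack Q c a B \<gamma> \<omega> \<kappa> \<phi> \<mu>,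
              r + t - sdp_dual_objective B U b \<theta> \<gamma> \<omega> \<phi> \<mu>)"
    and p2: "\<forall>i\<in>-B. \<phi> i \<le> 0" "entrywise_nonneg \<Theta>" "\<forall>v. 0 \<le> v \<bullet> (\<Omega> *v v)" "0 \<le> r"
    unfolding dual_defects_def by blast
  from q obtain \<gamma>' \<omega>' \<kappa>' \<phi>' \<mu>' \<Theta>' \<Omega>' r' where
    q1: "q = (\<Theta>' + \<Omega>' - dual_slack Q c a B \<gamma>' \<omega>' \<kappa>' \<phi>' \<mu>',
              r' + t - sdp_dual_objective B U b \<theta> \<gamma>' \<omega>' \<phi>' \<mu>')"
    and q2: "\<forall>i\<in>-B. \<phi>' i \<le> 0" "entrywise_nonneg \<Theta>'" "\<forall>v. 0 \<le> v \<bullet> (\<Omega>' *v v)" "0 \<le> r'"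
    unfolding dual_defects_def by blast
  let ?\<gamma> = "u *\<^sub>R \<gamma> + v *\<^sub>R \<gamma>'" and ?\<omega> = "u *\<^sub>R \<omega> + v *\<^sub>R \<omega>'"
    and ?\<kappa> = "\<lambda>i. u * \<kappa> i + v * \<kappa>' i" and ?\<phi> = "\<lambda>i. u * \<phi> i + v * \<phi>' i"
    and ?\<mu> = "u * \<mu> + v * \<mu>'" and ?\<Theta> = "u *\<^sub>R \<Theta> + v *\<^sub>R \<Theta>'"
    and ?\<Omega> = "u *\<^sub>R \<Omega> + v *\<^sub>R \<Omega>'" and ?r = "u * r + v * r'"
  have t: "u * t + v * t = t" using uv(3) by (simp flip: distrib_right)
  have 1: "\<forall>i\<in>-B. ?\<phi> i \<le> 0"
    using p2(1) q2(1) uv by (auto intro!: add_nonpos_nonpos mult_nonneg_nonpos)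
  have 2: "entrywise_nonneg ?\<Theta>" using p2(2) q2(2) uv by (simp add: entrywise_nonneg_def)
  have 3: "\<forall>w. 0 \<le> w \<bullet> (?\<Omega> *v w)"
    using p2(3) q2(3) uv by (simp add: matrix_vector_mult_add_rdistrib
        scaleR_matrix_vector_assoc[symmetric] inner_add_right)
  have 4: "0 \<le> ?r" using p2(4) q2(4) uv by simp
  have 5: "u *\<^sub>R p + v *\<^sub>R q = (?\<Theta> + ?\<Omega> - dual_slack Q c a B ?\<gamma> ?\<omega> ?\<kappa> ?\<phi> ?\<mu>,
      ?r + t - sdp_dual_objective B U b \<theta> ?\<gamma> ?\<omega> ?\<phi> ?\<mu>)"
    unfolding dual_slack_convex_combination[OF uv(3), symmetric]
      dual_objective_combination[symmetric] p1 q1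
    using t by (simp add: algebra_simps)
  show "u *\<^sub>R p + v *\<^sub>R q \<in> dual_defects Q c a B U b \<theta> t"
    unfolding dual_defects_def using 1 2 3 4 5 by blast
qed

lemma transpose_add: "transpose (M + N) = transpose M + (transpose N :: real^'k^'l)"
  by (simp add: transpose_def vec_eq_iff)

lemma transpose_diff: "transpose (M - N) = transpose M - (transpose N :: real^'k^'l)"
  by (simp add: transpose_def vec_eq_iff)

lemma transpose_sum: "transpose (\<Sum>i\<in>I. f i) = (\<Sum>i\<in>I. transpose (f i) :: real^'k^'l)"
  by (simp add: transpose_def vec_eq_iff)

lemma transpose_dual_slack:
  assumes "transpose Q = Q"
  shows "transpose (dual_slack Q c a B \<gamma> \<omega> \<kappa> \<phi> \<mu>) = dual_slack Q c a B \<gamma> \<omega> \<kappa> \<phi> \<mu>"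
proof -
  have o: "transpose (outer v v) = outer v v" for v :: "real^'n"
    by (simp add: transpose_def outer_def vec_eq_iff mult.commute)
  have o': "transpose (- outer v v) = - outer v v" for v :: "real^'n"
    by (simp add: transpose_def outer_def vec_eq_iff mult.commute)
  have z: "transpose (0 :: real^'n^'n) = 0" by (simp add: transpose_def vec_eq_iff)
  show ?thesis
    unfolding dual_slack_def dual_C_def dual_A_def dual_A_hat_def dual_B_def dual_G_def dual_H_def
    by (simp add: transpose_diff transpose_sum transpose_scalar transpose_bordered o o' z assms)
qed

text \<open>
  Averaging \<open>\<Theta>\<close> and \<open>\<Omega>\<close> with their transposes restores symmetry; their sum is the slack
  matrix, which is symmetric already.
\<close>

lemma zero_in_dual_defects_imp_dual_feasible:
  assumes Q: "transpose Q = Q" and "0 \<in> dual_defects Q c a B U b \<theta> t"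
  obtains \<gamma> \<omega> \<kappa> \<phi> \<mu> \<Theta> \<Omega> where "sdp_dual_feasible Q c a B \<gamma> \<omega> \<kappa> \<phi> \<mu> \<Theta> \<Omega>"
    and "t \<le> sdp_dual_objective B U b \<theta> \<gamma> \<omega> \<phi> \<mu>"
proof -
  from assms(2) obtain \<gamma> \<omega> \<kappa> \<phi> \<mu> \<Theta> \<Omega> r where
    slack: "dual_slack Q c a B \<gamma> \<omega> \<kappa> \<phi> \<mu> = \<Theta> + \<Omega>"
    and obj: "r + t = sdp_dual_objective B U b \<theta> \<gamma> \<omega> \<phi> \<mu>"
    and p: "\<forall>i\<in>-B. \<phi> i \<le> 0" "entrywise_nonneg \<Theta>" "\<forall>v. 0 \<le> v \<bullet> (\<Omega> *v v)" "0 \<le> r"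
    unfolding dual_defects_def zero_prod_def
    by clarsimp (metis eq_iff_diff_eq_0)
  define \<Theta>' \<Omega>' where "\<Theta>' = (1/2) *\<^sub>R (\<Theta> + transpose \<Theta>)"
    and "\<Omega>' = (1/2) *\<^sub>R (\<Omega> + transpose \<Omega>)"
  let ?S = "dual_slack Q c a B \<gamma> \<omega> \<kappa> \<phi> \<mu>"
  have "\<Theta>' + \<Omega>' = (1/2) *\<^sub>R (?S + transpose ?S)"
    unfolding slack transpose_add \<Theta>'_def \<Omega>'_def by (simp add: algebra_simps)
  also have "\<dots> = ?S" by (simp add: transpose_dual_slack[OF Q] flip: scaleR_2)
  finally have S: "?S = \<Theta>' + \<Omega>'" by simp
  have "v \<bullet> (\<Omega>' *v v) = v \<bullet> (\<Omega> *v v)" for v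
    by (simp add: \<Omega>'_def scaleR_matrix_vector_assoc[symmetric] matrix_vector_mult_add_rdistrib
        inner_add_right transpose_matrix_vector inner_commute[of v "v v* \<Omega>"] dot_lmul_matrix)
  then have "psd \<Omega>'"
    using p(3) by (simp add: psd_def \<Omega>'_def transpose_scalar transpose_add add.commute)
  moreover have "transpose \<Theta>' = \<Theta>'"
    by (simp add: \<Theta>'_def transpose_scalar transpose_add add.commute)
  moreover have "entrywise_nonneg \<Theta>'"
    using p(2) by (simp add: \<Theta>'_def entrywise_nonneg_def transpose_def)
  ultimately have "sdp_dual_feasible Q c a B \<gamma> \<omega> \<kappa> \<phi> \<mu> \<Theta>' \<Omega>'"
    using S p(1) by (simp add: sdp_dual_feasible_def dual_slack_def)
  moreover have "t \<le> sdp_dual_objective B U b \<theta> \<gamma> \<omega> \<phi> \<mu>" using obj p(4) by simp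
  ultimately show ?thesis by (rule that)
qed

text \<open>
  The normal \<open>(Y, z)\<close> of a hyperplane that separates the defects from the origin yields the
  required primal point as \<open>Y/z\<close>: each constraint is read off by moving a single multiplier to
  infinity, and the value bound by setting all multipliers to 0.
\<close>

lemma unreachable_dual_value_bounds_primal:
  fixes Q :: "real^'n^'n" and a :: "'m::finite \<Rightarrow> real^'n"
  assumes Q: "transpose Q = Q" and "0 \<notin> dual_defects Q c a B U b \<theta> t"
  obtains x X where "sdp_bd_feasible a B U b \<theta> x X" "sdp_bd_objective Q c x X \<le> t"
proof -
  obtain Y z where nz: "(Y, z) \<noteq> 0"
    and sep: "\<And>d. d \<in> dual_defects Q c a B U b \<theta> t \<Longrightarrow> 0 \<le> (Y, z) \<bullet> d"
    using separating_hyperplane_set_0[OF convex_dual_defects assms(2)] by force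
  have ineq: "0 \<le> Y \<bullet> \<Theta> + Y \<bullet> \<Omega> + z * r + z * t
        - (dual_slack Q c a B \<gamma> \<omega> \<kappa> \<phi> \<mu> \<bullet> Y + z * sdp_dual_objective B U b \<theta> \<gamma> \<omega> \<phi> \<mu>)"
    if "\<forall>i\<in>-B. \<phi> i \<le> 0" "entrywise_nonneg \<Theta>" "\<forall>v. 0 \<le> v \<bullet> (\<Omega> *v v)" "0 \<le> r"
    for \<gamma> \<omega> \<kappa> \<phi> \<mu> \<Theta> \<Omega> r
  proof -
    have "(\<Theta> + \<Omega> - dual_slack Q c a B \<gamma> \<omega> \<kappa> \<phi> \<mu>,
        r + t - sdp_dual_objective B U b \<theta> \<gamma> \<omega> \<phi> \<mu>) \<in> dual_defects Q c a B U b \<theta> t"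
      unfolding dual_defects_def using that by blast
    from sep[OF this] show ?thesis
      by (simp add: inner_add_right inner_diff_right inner_commute algebra_simps)
  qed
  \<comment> \<open>The right-hand side of \<open>ineq\<close> at zero multipliers, the base point of the rays below.\<close>
  define \<beta> where "\<beta> = z * t - (dual_slack Q c a B 0 0 (\<lambda>_. 0) (\<lambda>_. 0) 0 \<bullet> Y
    + z * sdp_dual_objective B U b \<theta> 0 0 (\<lambda>_. 0) 0)"
  have cone_\<Theta>: "0 \<le> Y \<bullet> \<Theta>" if "entrywise_nonneg \<Theta>" for \<Theta>
  proof (rule nonneg_on_ray_imp_slope_nonneg)
    show "0 \<le> \<beta> + k * (Y \<bullet> \<Theta>)" if "0 \<le> k" for k
      using ineq[of "\<lambda>_. 0" "k *\<^sub>R \<Theta>" 0 0 0 0 "\<lambda>_. 0" 0] that \<open>entrywise_nonneg \<Theta>\<close>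
      by (simp add: \<beta>_def entrywise_nonneg_def)
  qed
  have cone_\<Omega>: "0 \<le> Y \<bullet> \<Omega>" if "\<forall>v. 0 \<le> v \<bullet> (\<Omega> *v v)" for \<Omega>
  proof (rule nonneg_on_ray_imp_slope_nonneg)
    show "0 \<le> \<beta> + k * (Y \<bullet> \<Omega>)" if "0 \<le> k" for k
      using ineq[of "\<lambda>_. 0" 0 "k *\<^sub>R \<Omega>" 0 0 0 "\<lambda>_. 0" 0] that \<open>\<forall>v. 0 \<le> v \<bullet> (\<Omega> *v v)\<close>
      by (simp add: \<beta>_def entrywise_nonneg_def scaleR_matrix_vector_assoc[symmetric])
  qed
  have z_nonneg: "0 \<le> z"
  proof (rule nonneg_on_ray_imp_slope_nonneg)
    show "0 \<le> \<beta> + k * z" if "0 \<le> k" for k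
      using ineq[of "\<lambda>_. 0" 0 0 k 0 0 "\<lambda>_. 0" 0] that
      by (simp add: \<beta>_def entrywise_nonneg_def mult.commute)
  qed
  have nonneg: "entrywise_nonneg Y"
    unfolding entrywise_nonneg_def
  proof (intro allI)
    fix i j
    have "entrywise_nonneg (outer (axis i 1) (axis j 1) :: real^('n option)^('n option))"
      by (simp add: entrywise_nonneg_def outer_def axis_def)
    from cone_\<Theta>[OF this] show "0 \<le> Y $ i $ j"
      by (simp add: inner_commute[of Y] inner_outer matrix_vector_axis inner_axis' column_def)
  qed
  have sym: "transpose Y = Y"
  proof -
    \<comment> \<open>The quadratic form of the antisymmetric part is identically zero, so its
      negative is an admissible choice of \<open>\<Omega>\<close>.\<close>
    define N where "N = Y - transpose Y"
    have "v \<bullet> (transpose Y *v v) = v \<bullet> (Y *v v)" for v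
      by (simp add: transpose_matrix_vector inner_commute[of v "v v* Y"] dot_lmul_matrix)
    then have "v \<bullet> ((- N) *v v) = 0" for v
      by (simp add: N_def matrix_vector_mult_diff_rdistrib inner_diff_right)
    then have "0 \<le> Y \<bullet> (- N)" by (intro cone_\<Omega>) simp
    moreover have "N \<bullet> N = 2 * (Y \<bullet> N)"
      using inner_transpose[of Y Y] inner_transpose[of "transpose Y" Y]
      by (simp add: N_def inner_diff_left inner_diff_right inner_commute)
    ultimately have "N \<bullet> N \<le> 0" by simp
    then have "N = 0" by (metis inner_eq_zero_iff inner_ge_zero order_antisym)
    then show ?thesis by (simp add: N_def)
  qed
  have psd: "psd Y"
    unfolding psd_def
  proof (intro conjI allI sym)
    fix v :: "real^('n option)"
    have "w \<bullet> (outer v v *v w) = (v \<bullet> w)\<^sup>2" for w :: "real^('n option)"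
      by (simp add: inner_vec_def outer_def matrix_vector_mult_def power2_eq_square
          sum_distrib_left sum_distrib_right mult_ac)
    then have "0 \<le> Y \<bullet> outer v v" by (intro cone_\<Omega>) simp
    then show "0 \<le> v \<bullet> (Y *v v)" by (simp add: inner_commute[of Y] inner_outer)
  qed
  obtain s x X where Y: "Y = bordered s x X" and X: "transpose X = X"
    using symmetric_is_bordered[OF sym] by blast
  define \<alpha> where "\<alpha> = z * t - (c \<bullet> x + Q \<bullet> X)"
  have lagrangian: "0 \<le> \<alpha>
     - (\<Sum>j\<in>UNIV. \<gamma> $ j * (z * b j \<theta> - a j \<bullet> x))
     - (\<Sum>j\<in>UNIV. \<omega> $ j * (z * (b j \<theta>)\<^sup>2 - outer (a j) (a j) \<bullet> X))
     + (\<Sum>i\<in>B. \<kappa> i * (x $ i - X $ i $ i))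
     - (\<Sum>i\<in>-B. \<phi> i * (z * (U i)\<^sup>2 - X $ i $ i))
     - \<mu> * (z - s)" if "\<forall>i\<in>-B. \<phi> i \<le> 0" for \<gamma> \<omega> \<kappa> \<phi> \<mu>
    using ineq[of \<phi> 0 0 0 \<gamma> \<omega> \<kappa> \<mu>] that
    unfolding Y lagrangian_identity by (simp add: \<alpha>_def entrywise_nonneg_def)
  have s: "s = z"
    using nonneg_on_line_imp_slope_zero[of \<alpha> "s - z"] lagrangian[of "\<lambda>_. 0" 0 0 "\<lambda>_. 0"]
    by (simp add: algebra_simps)
  have eq_A: "a j \<bullet> x = z * b j \<theta>" for j
  proof -
    have "0 \<le> \<alpha> + k * (a j \<bullet> x - z * b j \<theta>)" for k
      using lagrangian[of "\<lambda>_. 0" "axis j k" 0 "\<lambda>_. 0" 0] unfolding sum_axis_mult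
      by (simp add: algebra_simps)
    from nonneg_on_line_imp_slope_zero[OF this] show ?thesis by simp
  qed
  have eq_A_hat: "outer (a j) (a j) \<bullet> X = z * (b j \<theta>)\<^sup>2" for j
  proof -
    have "0 \<le> \<alpha> + k * (outer (a j) (a j) \<bullet> X - z * (b j \<theta>)\<^sup>2)" for k
      using lagrangian[of "\<lambda>_. 0" 0 "axis j k" "\<lambda>_. 0" 0] unfolding sum_axis_mult
      by (simp add: algebra_simps)
    from nonneg_on_line_imp_slope_zero[OF this] show ?thesis by simp
  qed
  have eq_B: "x $ i = X $ i $ i" if "i \<in> B" for i
  proof -
    have "0 \<le> \<alpha> + k * (x $ i - X $ i $ i)" for k
      using lagrangian[of "\<lambda>_. 0" 0 0 "\<lambda>i'. if i' = i then k else 0" 0]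
      unfolding sum_single_multiplier[OF finite that] by simp
    from nonneg_on_line_imp_slope_zero[OF this] show ?thesis by simp
  qed
  have le_G: "X $ i $ i \<le> z * (U i)\<^sup>2" if "i \<in> - B" for i
  proof -
    have "0 \<le> \<alpha> + k * (z * (U i)\<^sup>2 - X $ i $ i)" if "0 \<le> k" for k
    proof -
      have "\<forall>i'\<in>- B. (if i' = i then - k else 0) \<le> 0" using that by simp
      from lagrangian[OF this, of 0 0 "\<lambda>_. 0" 0] show ?thesis
        unfolding sum_single_multiplier[OF finite \<open>i \<in> - B\<close>] by simp
    qed
    from nonneg_on_ray_imp_slope_nonneg[OF this] show ?thesis by simp
  qed
  \<comment> \<open>For \<open>z = 0\<close> the constraints on \<open>Y\<close> are homogeneous, and \<open>Y\<close> is a recession direction.\<close>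
  have "z \<noteq> 0"
  proof
    assume z: "z = 0"
    have border: "x = 0"
      using arg_cong[OF psd_zero_diagonal_imp_zero_row[OF psd, of None], of "\<lambda>w. w $ Some _"] s z
      by (simp add: Y vec_eq_iff)
    have "X $ i $ i = 0" for i
    proof (cases "i \<in> B")
      case True then show ?thesis using eq_B border by fastforce
    next
      case False
      then have "X $ i $ i \<le> 0" using le_G[of i] z by simp
      moreover have "0 \<le> X $ i $ i" using psd_diagonal_nonneg[OF psd, of "Some i"] by (simp add: Y)
      ultimately show ?thesis by simp
    qed
    then have "Y $ p $ p = 0" for p
      using s z by (cases p) (simp_all add: Y)
    then have "Y = 0" using psd_zero_diagonal_imp_zero_row[OF psd] by (simp add: vec_eq_iff)
    with z nz show False by (simp add: zero_prod_def)
  qed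
  with z_nonneg have z: "0 < z" by simp
  have normalized: "bordered 1 ((1/z) *\<^sub>R x) ((1/z) *\<^sub>R X) = (1/z) *\<^sub>R Y"
    using z s by (simp add: Y scaleR_bordered)
  have "sdp_bd_feasible a B U b \<theta> ((1/z) *\<^sub>R x) ((1/z) *\<^sub>R X)"
    unfolding sdp_bd_feasible_def normalized trace_outer_mult
  proof (intro conjI allI ballI)
    show "transpose ((1/z) *\<^sub>R X) = (1/z) *\<^sub>R X" by (simp add: transpose_scalar X)
    show "a j \<bullet> ((1/z) *\<^sub>R x) = b j \<theta>" for j using z by (simp add: eq_A)
    show "outer (a j) (a j) \<bullet> ((1/z) *\<^sub>R X) = (b j \<theta>)\<^sup>2" for j using z by (simp add: eq_A_hat)
    show "((1/z) *\<^sub>R X) $ i $ i \<le> (U i)\<^sup>2" if "i \<in> - B" for i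
      using le_G[OF that] z by (simp add: pos_divide_le_eq mult.commute)
    show "((1/z) *\<^sub>R x) $ i = ((1/z) *\<^sub>R X) $ i $ i" if "i \<in> B" for i
      using eq_B[OF that] by simp
    show "psd ((1/z) *\<^sub>R Y)"
      using psd z by (simp add: psd_def transpose_scalar scaleR_matrix_vector_assoc[symmetric])
    show "entrywise_nonneg ((1/z) *\<^sub>R Y)"
      using nonneg z by (simp add: entrywise_nonneg_def)
  qed
  moreover have "sdp_bd_objective Q c ((1/z) *\<^sub>R x) ((1/z) *\<^sub>R X) \<le> t"
  proof -
    have "c \<bullet> x + Q \<bullet> X \<le> z * t" using lagrangian[of "\<lambda>_. 0" 0 0 "\<lambda>_. 0" 0] by (simp add: \<alpha>_def)
    then have "(c \<bullet> x + Q \<bullet> X) / z \<le> t" using z by (simp add: pos_divide_le_eq mult.commute)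
    then show ?thesis
      unfolding sdp_bd_objective_def trace_transpose_mult
      by (simp add: add_divide_distrib add.commute)
  qed
  ultimately show ?thesis by (rule that)
qed

theorem proposition1:
  fixes Q :: "real^'n^'n" and c :: "real^'n"
    and a :: "'m::finite \<Rightarrow> real^'n" and B :: "'n set"
    and b :: "'m \<Rightarrow> real \<Rightarrow> real" and \<theta> :: real
    and U :: "'n \<Rightarrow> real"
  assumes Q_psd: "psd Q"
    and b_differentiable: "\<And>j t. b j differentiable (at t)"
    and feasible: "\<exists>x. mbqp_feasible a B b \<theta> x"
    and bounded: "\<And>i x. i \<notin> B \<Longrightarrow> mbqp_feasible a B b \<theta> x \<Longrightarrow> x $ i \<le> U i"
  shows "sdp_bd_value Q c a B U b \<theta> = sdp_dual_value Q c a B U b \<theta>"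
proof (rule antisym)
  show "sdp_dual_value Q c a B U b \<theta> \<le> sdp_bd_value Q c a B U b \<theta>"
    unfolding sdp_dual_value_def sdp_bd_value_def
    by (intro Sup_least Inf_greatest, clarsimp) (erule (1) weak_duality)
  show "sdp_bd_value Q c a B U b \<theta> \<le> sdp_dual_value Q c a B U b \<theta>"
  proof (rule ccontr)
    assume "\<not> ?thesis"
    then have "sdp_dual_value Q c a B U b \<theta> < sdp_bd_value Q c a B U b \<theta>" by simp
    from ereal_dense2[OF this] obtain t where t: "sdp_dual_value Q c a B U b \<theta> < ereal t"
        "ereal t < sdp_bd_value Q c a B U b \<theta>" by blast
    have Q: "transpose Q = Q" using Q_psd by (simp add: psd_def)
    have "0 \<notin> dual_defects Q c a B U b \<theta> t"
    proof
      assume "0 \<in> dual_defects Q c a B U b \<theta> t"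
      then obtain \<gamma> \<omega> \<kappa> \<phi> \<mu> \<Theta> \<Omega> where
        D: "sdp_dual_feasible Q c a B \<gamma> \<omega> \<kappa> \<phi> \<mu> \<Theta> \<Omega>"
        and "t \<le> sdp_dual_objective B U b \<theta> \<gamma> \<omega> \<phi> \<mu>"
        using zero_in_dual_defects_imp_dual_feasible[OF Q] by metis
      then have "ereal t \<le> ereal (sdp_dual_objective B U b \<theta> \<gamma> \<omega> \<phi> \<mu>)" by simp
      also have "\<dots> \<le> sdp_dual_value Q c a B U b \<theta>"
        unfolding sdp_dual_value_def using D by (intro Sup_upper) blast
      finally show False using t(1) by simp
    qed
    then obtain x X where P: "sdp_bd_feasible a B U b \<theta> x X"
      and "sdp_bd_objective Q c x X \<le> t"
      using unreachable_dual_value_bounds_primal[OF Q] by metis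
    have "sdp_bd_value Q c a B U b \<theta> \<le> ereal (sdp_bd_objective Q c x X)"
      unfolding sdp_bd_value_def using P by (intro Inf_lower) blast
    also have "\<dots> \<le> ereal t" using \<open>sdp_bd_objective Q c x X \<le> t\<close> by simp
    finally show False using t(2) by simp
  qed
qed

end
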